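(* Let $(\Lambda^*\mathcal{A},\mathbf{d})$ be a symmetric lattice reduction on $\mathcal{L}$ (as defined in the context) whose graph has no opposite edges, i.e. $\mathbf{b}_{m,p,m}=0$ in $\Lambda^2\mathcal{A}$ for all $m,p\in\mathcal{L}$. Then the basis vector fields $\partial^{v_j}$, $j\in[n]\cup[n]'$, mutually commute when acting on functions: $$\partial^{v_j}(\partial^{v_k}f)=\partial^{v_k}(\partial^{v_j}f)\qquad\text{for all } j,k\in[n]\cup[n]'\text{ and all } f\in\mathcal{A}.$$
   Context: Lattice. Let $v_1,\dots,v_n$ be linearly independent vectors in $\mathbb{R}^n$ and $\mathcal{L}=\mathbb{Z}v_1+\dots+\mathbb{Z}v_n\cong\mathbb{Z}^n$. Put $[n]=\{1,\dots,n\}$, $[n]'=\{1',\dots,n'\}$ (disjoint copies, with $(j')'=j$) and $v_{j'}=-v_j$ for $j\in[n]$. Let $\mathcal{A}$ be the algebra of all functions $f:\mathcal{L}\to\mathbb{C}$ with pointwise operations, and let $\mathbf{b}_m\in\mathcal{A}$ be the delta function at $m$, $\mathbf{b}_m(p)=\delta_{mp}$. Universal calculus. For $r\ge 0$ let $\Omega^r$ be the space of all formal, possibly infinite, complex linear combinations of symbols $\mathbf{b}_{m^0,\dots,m^r}$ with $m^i\in\mathcal{L}$ and $m^{i}\neq m^{i+1}$ for all $i$; by convention $\mathbf{b}_{m^0,\dots,m^r}=0$ if two consecutive indices coincide. Thus $\Omega^0=\mathcal{A}$, where $f=\sum_m f(m)\mathbf{b}_m$. The product on $\Omega^*=\bigoplus_r\Omega^r$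 is concatenation, $\mathbf{b}_{m^0,\dots,m^r}\,\mathbf{b}_{p^0,\dots,p^s}=\delta_{m^r p^0}\,\mathbf{b}_{m^0,\dots,m^r,p^1,\dots,p^s}$, extended to infinite combinations (this is well defined coefficientwise). The exterior derivative is $$\mathbf{d}\,\mathbf{b}_{m^0,\dots,m^r}=\sum_{l\in\mathcal{L}}\sum_{s=0}^{r+1}(-1)^s\,\mathbf{b}_{m^0,\dots,m^{s-1},l,m^s,\dots,m^r},$$ extended to infinite combinations (also well defined coefficientwise). It satisfies $\mathbf{d}^2=0$ and the graded Leibniz rule $\mathbf{d}(\omega_r\omega_s)=(\mathbf{d}\omega_r)\omega_s+(-1)^r\omega_r\,\mathbf{d}\omega_s$ for $\omega_r\in\Omega^r$ and $\omega_s\in\Omega^s$. Symmetric lattice reduction. This is a quotient $\Lambda^*\mathcal{A}=\Omega^*/\mathcal{J}$ with the induced product and $\mathbf{d}$, where $\mathcal{J}=\bigoplus_r\mathcal{J}^r$ is a graded two-sided ideal with $\mathcal{J}^0=0$, stable under $\mathbf{d}$, with each $\mathcal{J}^r$ closed in $\Omega^r$ for coefficientwise convergence (so that infinite formal sums make sense in the quotient), and such that, for $m,p\in\mathcal{L}$, in $\Lambda^1\mathcal{A}$ one has $\mathbf{b}_{m,p}\ne0$ if $p=m+v_j$ for some $j\in[n]\cup[n]'$, and $\mathbf{b}_{m,p}=0$ otherwise. The nonvanishing $\mathbf{b}_{m,p}$ are the edges of the associated graph on $\mathcal{L}$. One-forms and vector fields. For $j\in[n]\cup[n]'$, $\Theta^{v_j}=\sum_{m\in\mathcal{L}}\mathbf{b}_{m,m+v_j}\in\Lambda^1\mathcal{A}$.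 The vector fields $\partial^{v_j}$ form the basis dual to the $\Theta^{v_j}$; as operators on $\mathcal{A}$ they are given by $$(\partial^{v_j}f)(m)=f(m+v_j)-f(m)\qquad(f\in\mathcal{A},\ m\in\mathcal{L}),$$ and they satisfy $\mathbf{d}f=\sum_{j\in[n]\cup[n]'}(\partial^{v_j}f)\,\Theta^{v_j}$. *)

theory Defs
  imports "HOL-Analysis.Analysis"
begin

text \<open>The index type \<open>'n + 'n\<close> plays the role of \<open>[n] \<union> [n]'\<close>: \<open>Inl j\<close> is \<open>j\<close> and
  \<open>Inr j\<close> is \<open>j'\<close>.\<close>

definition lattice :: "('n::finite \<Rightarrow> real ^ 'n) \<Rightarrow> (real ^ 'n) set" where
  "lattice v = range (\<lambda>c :: 'n \<Rightarrow> int. \<Sum>j\<in>UNIV. of_int (c j) *\<^sub>R v j)"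

fun step :: "('n::finite \<Rightarrow> real ^ 'n) \<Rightarrow> 'n + 'n \<Rightarrow> real ^ 'n" where
  "step v (Inl j) = v j"
| "step v (Inr j) = - v j"

text \<open>Functions on the lattice are represented by functions on the ambient space vanishing off it.\<close>

definition lattice_funs :: "('n::finite \<Rightarrow> real ^ 'n) \<Rightarrow> (real ^ 'n \<Rightarrow> complex) set" where
  "lattice_funs v = {f. \<forall>m. m \<notin> lattice v \<longrightarrow> f m = 0}"

definition lattice_one :: "('n::finite \<Rightarrow> real ^ 'n) \<Rightarrow> real ^ 'n \<Rightarrow> complex" where
  "lattice_one v = (\<lambda>m. if m \<in> lattice v then 1 else 0)"

text \<open>A formal, possibly infinite, combination of the symbols \<open>b\<close> indexed by \<open>m0, ..., mr\<close> is
  represented by its coefficient function on lists \<open>[m0, ..., mr]\<close>.\<close>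

type_synonym 'n form = "(real ^ 'n) list \<Rightarrow> complex"

definition paths :: "('n::finite \<Rightarrow> real ^ 'n) \<Rightarrow> (real ^ 'n) list set" where
  "paths v = {ms. ms \<noteq> [] \<and> set ms \<subseteq> lattice v \<and> distinct_adj ms}"

definition Omega :: "('n::finite \<Rightarrow> real ^ 'n) \<Rightarrow> nat \<Rightarrow> 'n form set" where
  "Omega v r = {w. \<forall>ms. w ms \<noteq> 0 \<longrightarrow> ms \<in> paths v \<and> length ms = Suc r}"

definition bsym :: "(real ^ 'n) list \<Rightarrow> ('n::finite) form" where
  "bsym ms = (\<lambda>qs. if qs = ms \<and> distinct_adj ms then 1 else 0)"

definition form0 :: "(real ^ 'n \<Rightarrow> complex) \<Rightarrow> ('n::finite) form" where
  "form0 f = (\<lambda>qs. case qs of [m] \<Rightarrow> f m | _ \<Rightarrow> 0)"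

text \<open>Coefficient of \<open>[q0, ..., qt]\<close> in the concatenation product: the only pairs of symbols that
  contribute are \<open>[q0, ..., qi]\<close>, \<open>[qi, ..., qt]\<close>.\<close>

definition concat_prod :: "('n::finite) form \<Rightarrow> 'n form \<Rightarrow> 'n form" (infixl \<open>\<odot>\<close> 70) where
  "w \<odot> u = (\<lambda>qs. \<Sum>i<length qs. w (take (Suc i) qs) * u (drop i qs))"

text \<open>Coefficient of \<open>[q0, ..., qt]\<close> in the exterior derivative: inserting \<open>l\<close> at position \<open>s\<close> of
  \<open>ms\<close> gives \<open>qs\<close> iff \<open>l = qs ! s\<close> and \<open>ms\<close> is \<open>qs\<close> with its entry at position \<open>s\<close> deleted.
  Lists with coinciding neighbours stand for the zero symbol and get coefficient 0.\<close>

definition ext_deriv :: "('n::finite \<Rightarrow> real ^ 'n) \<Rightarrow> 'n form \<Rightarrow> 'n form" where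
  "ext_deriv v w = (\<lambda>qs. if qs \<in> paths v
     then \<Sum>s<length qs. (- 1) ^ s * w (take s qs @ drop (Suc s) qs) else 0)"

definition graded_ideal ::
  "('n::finite \<Rightarrow> real ^ 'n) \<Rightarrow> (nat \<Rightarrow> 'n form set) \<Rightarrow> bool" where
  "graded_ideal v J \<longleftrightarrow>
     (\<forall>r. J r \<subseteq> Omega v r) \<and>
     (\<forall>r. (\<lambda>_. 0) \<in> J r) \<and>
     (\<forall>r. \<forall>w\<in>J r. \<forall>u\<in>J r. (\<lambda>ms. w ms + u ms) \<in> J r) \<and>
     (\<forall>r a. \<forall>w\<in>J r. (\<lambda>ms. a * w ms) \<in> J r) \<and>
     (\<forall>r s. \<forall>w\<in>J r. \<forall>u\<in>Omega v s. w \<odot> u \<in> J (r + s) \<and> u \<odot> w \<in> J (s + r))"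

text \<open>The class of an \<open>r\<close>-form in the quotient, as a coset.\<close>

definition form_class :: "(nat \<Rightarrow> ('n::finite) form set) \<Rightarrow> nat \<Rightarrow> 'n form \<Rightarrow> 'n form set" where
  "form_class J r w = (\<lambda>u ms. w ms + u ms) ` J r"

definition Lambda ::
  "('n::finite \<Rightarrow> real ^ 'n) \<Rightarrow> (nat \<Rightarrow> 'n form set) \<Rightarrow> nat \<Rightarrow> 'n form set set" where
  "Lambda v J r = form_class J r ` Omega v r"

definition class_zero :: "(nat \<Rightarrow> ('n::finite) form set) \<Rightarrow> nat \<Rightarrow> 'n form set" where
  "class_zero J r = form_class J r (\<lambda>_. 0)"

text \<open>The topology on the function type \<open>'n form\<close> is the product topology, i.e. that of
  coefficientwise convergence.\<close>

definition symmetric_lattice_reduction ::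
  "('n::finite \<Rightarrow> real ^ 'n) \<Rightarrow> (nat \<Rightarrow> 'n form set) \<Rightarrow> bool" where
  "symmetric_lattice_reduction v J \<longleftrightarrow>
     graded_ideal v J \<and>
     J 0 = {\<lambda>_. 0} \<and>
     (\<forall>r. \<forall>w\<in>J r. ext_deriv v w \<in> J (Suc r)) \<and>
     (\<forall>r. closedin (top_of_set (Omega v r)) (J r)) \<and>
     (\<forall>m\<in>lattice v. \<forall>p\<in>lattice v.
        form_class J 1 (bsym [m, p]) \<noteq> class_zero J 1 \<longleftrightarrow> (\<exists>j. p = m + step v j))"

definition no_opposite_edges ::
  "('n::finite \<Rightarrow> real ^ 'n) \<Rightarrow> (nat \<Rightarrow> 'n form set) \<Rightarrow> bool" where
  "no_opposite_edges v J \<longleftrightarrow>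
     (\<forall>m\<in>lattice v. \<forall>p\<in>lattice v. form_class J 2 (bsym [m, p, m]) = class_zero J 2)"

text \<open>The infinite formal sum of the \<open>bsym [m, m + step v j]\<close> over lattice points \<open>m\<close>.\<close>

definition Theta_form :: "('n::finite \<Rightarrow> real ^ 'n) \<Rightarrow> 'n + 'n \<Rightarrow> 'n form" where
  "Theta_form v j = (\<lambda>qs. if \<exists>m\<in>lattice v. qs = [m, m + step v j] then 1 else 0)"

definition Theta ::
  "('n::finite \<Rightarrow> real ^ 'n) \<Rightarrow> (nat \<Rightarrow> 'n form set) \<Rightarrow> 'n + 'n \<Rightarrow> 'n form set" where
  "Theta v J j = form_class J 1 (Theta_form v j)"

text \<open>Vector fields are the left linear maps from one-forms to functions; they are fixed to be
  \<open>undefined\<close> off \<open>Lambda v J 1\<close>, so that equality of vector fields is equality of functions.\<close>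

definition vector_fields ::
  "('n::finite \<Rightarrow> real ^ 'n) \<Rightarrow> (nat \<Rightarrow> 'n form set) \<Rightarrow> ('n form set \<Rightarrow> real ^ 'n \<Rightarrow> complex) set" where
  "vector_fields v J = {X \<in> Lambda v J 1 \<rightarrow>\<^sub>E lattice_funs v.
     (\<forall>w\<in>Omega v 1. \<forall>u\<in>Omega v 1.
        X (form_class J 1 (\<lambda>ms. w ms + u ms)) =
          (\<lambda>m. X (form_class J 1 w) m + X (form_class J 1 u) m)) \<and>
     (\<forall>f\<in>lattice_funs v. \<forall>w\<in>Omega v 1.
        X (form_class J 1 (form0 f \<odot> w)) = (\<lambda>m. f m * X (form_class J 1 w) m))}"

text \<open>The basis dual to the \<open>Theta v J k\<close>.\<close>

definition basis_field ::
  "('n::finite \<Rightarrow> real ^ 'n) \<Rightarrow> (nat \<Rightarrow> 'n form set) \<Rightarrow> 'n + 'n \<Rightarrow> 'n form set \<Rightarrow> real ^ 'n \<Rightarrow> complex"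
where
  "basis_field v J j = (THE X. X \<in> vector_fields v J \<and>
     (\<forall>k. X (Theta v J k) = (if k = j then lattice_one v else (\<lambda>_. 0))))"

text \<open>A vector field acts on a function through its value on the differential of the function.
  For the basis fields of a symmetric lattice reduction this is the finite difference
  \<open>f (m + step v j) - f m\<close> at lattice points \<open>m\<close>; that is a consequence of the definitions,
  not built into them.\<close>

definition vf_partial ::
  "('n::finite \<Rightarrow> real ^ 'n) \<Rightarrow> (nat \<Rightarrow> 'n form set) \<Rightarrow> 'n + 'n \<Rightarrow>
     (real ^ 'n \<Rightarrow> complex) \<Rightarrow> real ^ 'n \<Rightarrow> complex"
where
  "vf_partial v J j f = basis_field v J j (form_class J 1 (ext_deriv v (form0 f)))"

end

theory Submission
  imports Defs
begin

text \<open>Two-sided multiplication of a form by delta functions isolates single coefficients, so the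
  one-forms in \<open>J\<close> vanish on the edges; coefficientwise closedness gives the converse. Hence the
  class of a one-form is determined by its edge coefficients, the \<open>\<Theta>\<close>'s are a basis, and
  the dual basis reads off these coefficients. Applied to a differential, it gives the difference
  operator \<open>f (m + step v j) - f m\<close>; such operators commute because translations do.\<close>

section \<open>Lattice points and steps\<close>

lemma lattice_add:
  assumes "x \<in> lattice v" and "y \<in> lattice v"
  shows "x + y \<in> lattice v"
proof -
  obtain c d where "x = (\<Sum>j\<in>UNIV. of_int (c j) *\<^sub>R v j)" "y = (\<Sum>j\<in>UNIV. of_int (d j) *\<^sub>R v j)"
    using assms by (auto simp: lattice_def)
  then have "x + y = (\<Sum>j\<in>UNIV. of_int (c j + d j) *\<^sub>R v j)"
    by (simp add: sum.distrib scaleR_left_distrib)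
  then show ?thesis
    unfolding lattice_def by (intro image_eqI[where x = "\<lambda>j. c j + d j"]) auto
qed

lemma step_in_lattice: "step v k \<in> lattice v"
proof -
  have *: "of_int c *\<^sub>R v j \<in> lattice v" for c j
  proof -
    have "(\<Sum>i\<in>UNIV. of_int (if i = j then c else 0) *\<^sub>R v i)
        = (\<Sum>i\<in>UNIV. if i = j then of_int c *\<^sub>R v i else 0)"
      by (intro sum.cong) auto
    then show ?thesis
      unfolding lattice_def by (intro image_eqI[where x = "\<lambda>i. if i = j then c else 0"]) auto
  qed
  show ?thesis
    using *[of 1] *[of "-1"] by (cases k) auto
qed

text \<open>For \<open>a = b\<close> the equation would force the nonzero vector \<open>v a\<close>
  to vanish; otherwise it puts \<open>v a\<close> in the span of the other vectors. This separates
  forward from backward steps.\<close>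

lemma independent_range_neq_uminus:
  fixes v :: "'i \<Rightarrow> 'a::real_vector"
  assumes "inj v" and "independent (range v)"
  shows "v a \<noteq> - v b"
proof
  assume eq: "v a = - v b"
  have nz: "v a \<noteq> 0"
    using assms(2) dependent_zero by (metis rangeI)
  have "a \<noteq> b"
  proof
    assume "a = b"
    then have "2 *\<^sub>R v a = 0"
      using eq by (simp add: scaleR_2 eq_neg_iff_add_eq_0)
    then show False
      using nz by simp
  qed
  then have "v b \<in> range v - {v a}"
    using assms(1) by (auto dest: injD)
  then have "v a \<in> span (range v - {v a})"
    unfolding eq by (intro span_neg span_base)
  then show False
    using assms(2) unfolding dependent_def by blast
qed

lemma inj_step:
  assumes "inj v" and "independent (range v)"
  shows "inj (step v)"
proof (rule injI)
  fix j k assume "step v j = step v k"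
  then show "j = k"
    using independent_range_neq_uminus[OF assms] injD[OF assms(1)]
    by (cases j; cases k) (auto, metis)
qed

lemma step_nonzero:
  assumes "independent (range v)"
  shows "step v j \<noteq> 0"
  using assms dependent_zero[of "range v"] by (cases j) (auto simp: image_iff)

section \<open>Zero-forms: products and differentials\<close>

lemma form0_eq_0: "length qs \<noteq> 1 \<Longrightarrow> form0 f qs = 0"
  by (auto simp: form0_def split: list.split)

lemma form0_singleton: "form0 f [m] = f m"
  by (simp add: form0_def)

lemma form0_in_Omega:
  assumes "f \<in> lattice_funs v"
  shows "form0 f \<in> Omega v 0"
  using assms by (auto simp: Omega_def form0_def paths_def lattice_funs_def split: list.splits)

text \<open>\<open>form0 f\<close> is evaluated at the prefix of length \<open>Suc i\<close>, so
  only the cut \<open>i = 0\<close> survives.\<close>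

lemma form0_prod:
  fixes f :: "real ^ 'n::finite \<Rightarrow> complex"
  shows "form0 f \<odot> w = (\<lambda>qs. if qs = [] then 0 else f (hd qs) * w qs)"
proof
  fix qs :: "(real ^ 'n) list"
  show "(form0 f \<odot> w) qs = (if qs = [] then 0 else f (hd qs) * w qs)"
  proof (cases qs)
    case (Cons a list)
    have "(\<Sum>i<length list. form0 f (take (Suc (Suc i)) qs) * w (drop (Suc i) qs)) = 0"
      by (intro sum.neutral) (auto simp: form0_eq_0 Cons)
    then show ?thesis
      by (simp add: concat_prod_def Cons sum.lessThan_Suc_shift form0_singleton del: sum.lessThan_Suc)
  qed (simp add: concat_prod_def)
qed

text \<open>Mirror image of the left product: only the last cut leaves a suffix of length
  one.\<close>

lemma prod_form0:
  fixes f :: "real ^ 'n::finite \<Rightarrow> complex"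
  shows "w \<odot> form0 f = (\<lambda>qs. if qs = [] then 0 else w qs * f (last qs))"
proof
  fix qs :: "(real ^ 'n) list"
  show "(w \<odot> form0 f) qs = (if qs = [] then 0 else w qs * f (last qs))"
  proof (cases qs rule: rev_cases)
    case (snoc list a)
    have "(\<Sum>i<length list. w (take (Suc i) qs) * form0 f (drop i qs)) = 0"
      by (intro sum.neutral) (auto simp: form0_eq_0 snoc)
    then show ?thesis
      by (simp add: concat_prod_def snoc form0_singleton)
  qed (simp add: concat_prod_def)
qed

lemma Omega_add: "w \<in> Omega v r \<Longrightarrow> u \<in> Omega v r \<Longrightarrow> (\<lambda>ms. w ms + u ms) \<in> Omega v r"
  unfolding Omega_def by (auto, (metis add.right_neutral add.left_neutral)+)

lemma Omega_scale: "w \<in> Omega v r \<Longrightarrow> (\<lambda>ms. a * w ms) \<in> Omega v r"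
  by (auto simp: Omega_def)

lemma Omega_sum:
  assumes "\<And>k. k \<in> K \<Longrightarrow> w k \<in> Omega v r"
  shows "(\<lambda>ms. \<Sum>k\<in>K. w k ms) \<in> Omega v r"
  unfolding Omega_def
proof (intro CollectI allI impI)
  fix ms assume "(\<Sum>k\<in>K. w k ms) \<noteq> 0"
  then obtain k where "k \<in> K" "w k ms \<noteq> 0"
    by (metis sum.neutral)
  then show "ms \<in> paths v \<and> length ms = Suc r"
    using assms[of k] by (auto simp: Omega_def)
qed

lemma form0_prod_in_Omega: "w \<in> Omega v r \<Longrightarrow> form0 f \<odot> w \<in> Omega v r"
  by (auto simp: Omega_def form0_prod)

lemma Omega1D:
  assumes "w \<in> Omega v 1" and "w qs \<noteq> 0"
  obtains m p where "qs = [m, p]" "m \<in> lattice v" "p \<in> lattice v" "m \<noteq> p"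
proof -
  have "qs \<in> paths v" "length qs = Suc (Suc 0)"
    using assms by (auto simp: Omega_def)
  then show ?thesis
    by (auto simp: length_Suc_conv paths_def intro: that)
qed

lemma ext_deriv_form0_in_Omega: "ext_deriv v (form0 f) \<in> Omega v 1"
  unfolding Omega_def
proof (intro CollectI allI impI)
  fix qs assume nz: "ext_deriv v (form0 f) qs \<noteq> 0"
  then have "qs \<in> paths v"
    by (auto simp: ext_deriv_def split: if_splits)
  moreover have "length qs = 2"
  proof (rule ccontr)
    assume "length qs \<noteq> 2"
    \<comment> \<open>Deleting one entry leaves a one-element list only if the length was two, so
      all summands vanish here.\<close>
    then have "form0 f (take s qs @ drop (Suc s) qs) = 0" if "s < length qs" for s
      using that by (intro form0_eq_0) auto
    then show False
      using nz by (simp add: ext_deriv_def split: if_splits)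
  qed
  ultimately show "qs \<in> paths v \<and> length qs = Suc 1"
    by simp
qed

lemma ext_deriv_form0_edge:
  assumes "m \<in> lattice v" and "p \<in> lattice v" and "m \<noteq> p"
  shows "ext_deriv v (form0 f) [m, p] = f p - f m"
  using assms by (simp add: ext_deriv_def paths_def form0_singleton)

text \<open>Both conditions on \<open>v\<close> together express linear independence of the family;
  the range alone would not detect a repeated vector.\<close>

locale reduction =
  fixes v :: "'n::finite \<Rightarrow> real ^ 'n" and J :: "nat \<Rightarrow> 'n form set"
  assumes inj: "inj v" and indep: "independent (range v)"
    and red: "symmetric_lattice_reduction v J"
begin

declare One_nat_def [simp del]

section \<open>The ideal and its cosets\<close>

lemma J_Omega: "w \<in> J r \<Longrightarrow> w \<in> Omega v r"
  and J_zero: "(\<lambda>_. 0) \<in> J r"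
  and J_add: "w \<in> J r \<Longrightarrow> u \<in> J r \<Longrightarrow> (\<lambda>ms. w ms + u ms) \<in> J r"
  and J_scale: "w \<in> J r \<Longrightarrow> (\<lambda>ms. a * w ms) \<in> J r"
  and J_mult: "w \<in> J r \<Longrightarrow> u \<in> Omega v s \<Longrightarrow> w \<odot> u \<in> J (r + s)"
  and J_lmult: "w \<in> J r \<Longrightarrow> u \<in> Omega v s \<Longrightarrow> u \<odot> w \<in> J (s + r)"
  using red unfolding symmetric_lattice_reduction_def graded_ideal_def by blast+

lemma J_closed: "closedin (top_of_set (Omega v r)) (J r)"
  and edge_iff: "m \<in> lattice v \<Longrightarrow> p \<in> lattice v \<Longrightarrow>
    form_class J 1 (bsym [m, p]) \<noteq> class_zero J 1 \<longleftrightarrow> (\<exists>j. p = m + step v j)"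
  using red unfolding symmetric_lattice_reduction_def by blast+

lemma J_sum:
  assumes "\<And>k. k \<in> K \<Longrightarrow> w k \<in> J r"
  shows "(\<lambda>ms. \<Sum>k\<in>K. w k ms) \<in> J r"
  using assms by (induction K rule: infinite_finite_induct) (auto intro: J_zero J_add)

lemma form_class_self: "w \<in> form_class J r w"
  unfolding form_class_def using J_zero by (force intro!: image_eqI[where x = "\<lambda>_. 0"])

lemma in_form_class_iff: "u \<in> form_class J r w \<longleftrightarrow> (\<lambda>ms. u ms - w ms) \<in> J r"
proof
  assume "(\<lambda>ms. u ms - w ms) \<in> J r"
  then show "u \<in> form_class J r w"
    unfolding form_class_def by (intro image_eqI[where x = "\<lambda>ms. u ms - w ms"]) auto
qed (auto simp: form_class_def)

lemma form_class_eq_iff: "form_class J r u = form_class J r w \<longleftrightarrow> (\<lambda>ms. u ms - w ms) \<in> J r"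
proof
  assume "form_class J r u = form_class J r w"
  then show "(\<lambda>ms. u ms - w ms) \<in> J r"
    using form_class_self in_form_class_iff by blast
next
  assume d: "(\<lambda>ms. u ms - w ms) \<in> J r"
  show "form_class J r u = form_class J r w"
  proof (intro set_eqI)
    fix x
    show "x \<in> form_class J r u \<longleftrightarrow> x \<in> form_class J r w"
      \<comment> \<open>\<open>x - w\<close> is the sum of \<open>x - u\<close> and
        \<open>u - w\<close>, and \<open>x - u\<close> is the sum of \<open>x - w\<close> and
        \<open>-(u - w)\<close>.\<close>
      using J_add[OF _ d, of "\<lambda>ms. x ms - u ms"]
        J_add[OF _ J_scale[OF d, of "-1"], of "\<lambda>ms. x ms - w ms"]
      by (auto simp: in_form_class_iff)
  qed
qed

section \<open>One-forms in the ideal\<close>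

lemma bsym_in_J_iff:
  assumes "m \<in> lattice v" and "p \<in> lattice v"
  shows "bsym [m, p] \<in> J 1 \<longleftrightarrow> (\<forall>j. p \<noteq> m + step v j)"
  using edge_iff[OF assms] form_class_eq_iff[of 1 "bsym [m, p]" "\<lambda>_. 0"]
  by (auto simp: class_zero_def)

lemma edge_distinct: "m \<noteq> m + step v j"
  using step_nonzero[OF indep] by simp

text \<open>Multiplying \<open>w\<close> by the delta functions at the two endpoints keeps it in the
  ideal and leaves a multiple of a single symbol. A nonzero factor could be divided out, placing an
  edge symbol in \<open>J 1\<close>.\<close>

lemma J1_edge_zero:
  assumes w: "w \<in> J 1" and m: "m \<in> lattice v"
  shows "w [m, m + step v j] = 0"
proof (rule ccontr)
  let ?p = "m + step v j"
  let ?\<delta> = "\<lambda>a x. if x = a then 1 else 0 :: complex"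
  assume nz: "w [m, ?p] \<noteq> 0"
  have p: "?p \<in> lattice v"
    using lattice_add m step_in_lattice by blast
  have "form0 (?\<delta> m) \<odot> w \<odot> form0 (?\<delta> ?p) \<in> J (0 + 1 + 0)"
    by (intro J_mult J_lmult w form0_in_Omega) (auto simp: lattice_funs_def m p)
  also have "form0 (?\<delta> m) \<odot> w \<odot> form0 (?\<delta> ?p) = (\<lambda>qs. w [m, ?p] * bsym [m, ?p] qs)"
  proof
    fix qs
    show "(form0 (?\<delta> m) \<odot> w \<odot> form0 (?\<delta> ?p)) qs = w [m, ?p] * bsym [m, ?p] qs"
    proof (cases "w qs = 0")
      case False
      then obtain a b where "qs = [a, b]" "a \<noteq> b"
        using Omega1D J_Omega w by metis
      then show ?thesis
        by (auto simp: form0_prod prod_form0 bsym_def)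
    qed (auto simp: form0_prod prod_form0 bsym_def nz)
  qed
  finally have "(\<lambda>qs. inverse (w [m, ?p]) * (w [m, ?p] * bsym [m, ?p] qs)) \<in> J 1"
    by (intro J_scale[of "\<lambda>qs. w [m, ?p] * bsym [m, ?p] qs"]) simp
  then have "bsym [m, ?p] \<in> J 1"
    using nz by (simp flip: mult.assoc)
  then show False
    using bsym_in_J_iff[OF m p] by blast
qed

text \<open>A one-form is the coefficientwise limit of its restrictions to finite sets of symbols.\<close>

lemma edge_zero_J1:
  assumes w: "w \<in> Omega v 1"
    and edge: "\<And>m j. m \<in> lattice v \<Longrightarrow> w [m, m + step v j] = 0"
  shows "w \<in> J 1"
proof -
  \<comment> \<open>Closedness is relative to \<open>Omega v 1\<close>, which contains
    \<open>w\<close> by assumption; it remains to place \<open>w\<close> in the ambient closed set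
    \<open>C\<close>.\<close>
  obtain C where C: "closed C" "J 1 = Omega v 1 \<inter> C"
    using J_closed by (auto simp: closedin_closed)
  define R where "R F = (\<lambda>qs. \<Sum>ps\<in>F. w ps * bsym ps qs)" for F
  have single: "(\<lambda>qs. w ps * bsym ps qs) \<in> J 1" for ps
  proof (cases "w ps = 0")
    case False
    then obtain m p where "ps = [m, p]" "m \<in> lattice v" "p \<in> lattice v"
      using Omega1D w by metis
    then show ?thesis
      using False edge bsym_in_J_iff by (intro J_scale) auto
  qed (simp add: J_zero)
  have "R F \<in> J 1" for F
    unfolding R_def by (intro J_sum single)
  moreover have "(R \<longlongrightarrow> w) (finite_subsets_at_top UNIV)"
  proof -
    have "((\<lambda>F. R F qs) \<longlongrightarrow> w qs) (finite_subsets_at_top UNIV)" for qs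
    proof (rule tendsto_eventually)
      \<comment> \<open>Each coefficient is already exact once \<open>F\<close> contains
        \<open>qs\<close>.\<close>
      have "R F qs = w qs" if "finite F" "{qs} \<subseteq> F" for F
      proof -
        \<comment> \<open>\<open>bsym qs qs\<close> is 0 for lists with coinciding neighbours, but
          there \<open>w\<close> vanishes too.\<close>
        have "w qs * bsym qs qs = w qs"
          using w by (auto simp: bsym_def Omega_def paths_def)
        moreover have "R F qs = (\<Sum>ps\<in>F. if ps = qs then w qs * bsym qs qs else 0)"
          unfolding R_def by (intro sum.cong) (auto simp: bsym_def)
        ultimately show ?thesis
          using that by simp
      qed
      then show "\<forall>\<^sub>F F in finite_subsets_at_top UNIV. R F qs = w qs"
        unfolding eventually_finite_subsets_at_top by (intro exI[of _ "{qs}"]) auto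
    qed
    \<comment> \<open>Coefficientwise limits are limits in the product topology, the one in which
      \<open>C\<close> is closed.\<close>
    then have "limitin (product_topology (\<lambda>_. euclidean) UNIV) R w (finite_subsets_at_top UNIV)"
      by (simp add: limitin_componentwise)
    then show ?thesis
      by (simp add: euclidean_product_topology)
  qed
  ultimately have "w \<in> C"
    using C by (intro Lim_in_closed_set[of C R]) auto
  then show ?thesis
    using C w by blast
qed

lemma form_class1_eq_iff:
  assumes "u \<in> Omega v 1" and "w \<in> Omega v 1"
  shows "form_class J 1 u = form_class J 1 w \<longleftrightarrow>
    (\<forall>m\<in>lattice v. \<forall>j. u [m, m + step v j] = w [m, m + step v j])"
proof -
  have "(\<lambda>ms. u ms - w ms) \<in> Omega v 1"
    using Omega_add[OF assms(1) Omega_scale[OF assms(2), of "-1"]] by simp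
  then have "(\<lambda>ms. u ms - w ms) \<in> J 1 \<longleftrightarrow>
      (\<forall>m\<in>lattice v. \<forall>j. u [m, m + step v j] - w [m, m + step v j] = 0)"
    using J1_edge_zero[of "\<lambda>ms. u ms - w ms"] edge_zero_J1[of "\<lambda>ms. u ms - w ms"] by blast
  then show ?thesis
    by (simp add: form_class_eq_iff)
qed

section \<open>Coordinates with respect to the forms \<open>Theta\<close>\<close>

lemma Theta_form_in_Omega: "Theta_form v j \<in> Omega v 1"
  using lattice_add[OF _ step_in_lattice] edge_distinct
  by (auto simp: Omega_def Theta_form_def paths_def split: if_splits)

text \<open>An edge shared by two of these forms would force equal steps, hence equal indices by
  \<open>inj_step\<close>.\<close>

lemma Theta_form_edge:
  assumes "m \<in> lattice v"
  shows "Theta_form v k [m, m + step v j] = (if k = j then 1 else 0)"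
  using assms injD[OF inj_step[OF inj indep], of j k] by (auto simp: Theta_form_def)

text \<open>The coordinate of \<open>w\<close> along \<open>Theta v J j\<close>, set to zero off the
  lattice so that it lies in \<open>lattice_funs v\<close>.\<close>

definition edge_coeff :: "'n form \<Rightarrow> 'n + 'n \<Rightarrow> real ^ 'n \<Rightarrow> complex" where
  "edge_coeff w j = (\<lambda>m. if m \<in> lattice v then w [m, m + step v j] else 0)"

text \<open>The choice of representative is harmless: two of them differ by an element of
  \<open>J 1\<close>, which vanishes on edges. The restriction supplies the value
  \<open>undefined\<close> that \<open>vector_fields\<close> demands off
  \<open>Lambda v J 1\<close>.\<close>

definition coeff_field :: "'n + 'n \<Rightarrow> 'n form set \<Rightarrow> real ^ 'n \<Rightarrow> complex" where
  "coeff_field j = (\<lambda>C\<in>Lambda v J 1. edge_coeff (SOME w. w \<in> C) j)"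

lemma edge_coeff_in_lattice_funs: "edge_coeff w j \<in> lattice_funs v"
  by (simp add: edge_coeff_def lattice_funs_def)

lemma coeff_field_class:
  assumes "w \<in> Omega v 1"
  shows "coeff_field j (form_class J 1 w) = edge_coeff w j"
proof -
  define u where "u = (SOME u. u \<in> form_class J 1 w)"
  have "u \<in> form_class J 1 w"
    unfolding u_def by (rule someI[of "\<lambda>u. u \<in> form_class J 1 w", OF form_class_self])
  then have "(\<lambda>ms. u ms - w ms) \<in> J 1"
    by (simp add: in_form_class_iff)
  then have "edge_coeff u j = edge_coeff w j"
    using J1_edge_zero by (fastforce simp: edge_coeff_def)
  then show ?thesis
    using assms by (simp add: coeff_field_def u_def Lambda_def)
qed

section \<open>Vector fields and the dual basis\<close>

lemma coeff_field_in_vector_fields: "coeff_field j \<in> vector_fields v J"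
proof -
  have "coeff_field j \<in> Lambda v J 1 \<rightarrow>\<^sub>E lattice_funs v"
    by (auto simp: coeff_field_def edge_coeff_in_lattice_funs)
  then show ?thesis
    unfolding vector_fields_def
    by (auto simp: coeff_field_class Omega_add form0_prod_in_Omega)
      (auto simp: edge_coeff_def form0_prod fun_eq_iff)
qed

lemma coeff_field_Theta: "coeff_field j (Theta v J k) = (if k = j then lattice_one v else (\<lambda>_. 0))"
  by (auto simp: Theta_def coeff_field_class Theta_form_in_Omega edge_coeff_def Theta_form_edge
      lattice_one_def)

lemma vector_field_sum:
  assumes X: "X \<in> vector_fields v J" and w: "\<And>k. w k \<in> Omega v 1"
  shows "X (form_class J 1 (\<lambda>ms. \<Sum>k\<in>K. w k ms)) m = (\<Sum>k\<in>K. X (form_class J 1 (w k)) m)"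
proof -
  have add: "X (form_class J 1 (\<lambda>ms. w ms + u ms)) =
      (\<lambda>m. X (form_class J 1 w) m + X (form_class J 1 u) m)"
    if "w \<in> Omega v 1" "u \<in> Omega v 1" for w u
    using X that unfolding vector_fields_def by blast
  \<comment> \<open>Additivity at 0 + 0 gives an equation x = x + x.\<close>
  have zero: "X (form_class J 1 (\<lambda>_. 0)) m = 0"
    using fun_cong[OF add[OF J_Omega J_Omega, OF J_zero J_zero], of m] by simp
  show ?thesis
    \<comment> \<open>For infinite \<open>K\<close> both sums default to zero, so the value at the
      zero form settles that case as well.\<close>
    by (induction K rule: infinite_finite_induct) (simp_all add: zero add w Omega_sum)
qed

text \<open>Both sides have the same edge coefficients. The sum over directions is finite, since the
  lattice points are absorbed into the coefficient functions.\<close>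

lemma form_class_expansion:
  assumes "w \<in> Omega v 1"
  shows "form_class J 1 w =
    form_class J 1 (\<lambda>ms. \<Sum>k\<in>UNIV. (form0 (edge_coeff w k) \<odot> Theta_form v k) ms)"
proof -
  have "(\<lambda>ms. \<Sum>k\<in>UNIV. (form0 (edge_coeff w k) \<odot> Theta_form v k) ms) \<in> Omega v 1"
    by (intro Omega_sum form0_prod_in_Omega Theta_form_in_Omega)
  then show ?thesis
    using assms
    by (simp add: form_class1_eq_iff form0_prod Theta_form_edge edge_coeff_def if_distrib cong: if_cong)
qed

text \<open>Uniqueness: by the expansion and left linearity, a vector field is determined by its
  values on the \<open>Theta v J k\<close>.\<close>

lemma basis_field_eq: "basis_field v J j = coeff_field j"
  unfolding basis_field_def
proof (rule the_equality)
  show "coeff_field j \<in> vector_fields v J \<and>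
      (\<forall>k. coeff_field j (Theta v J k) = (if k = j then lattice_one v else (\<lambda>_. 0)))"
    using coeff_field_in_vector_fields coeff_field_Theta by blast
next
  fix X assume X: "X \<in> vector_fields v J \<and>
      (\<forall>k. X (Theta v J k) = (if k = j then lattice_one v else (\<lambda>_. 0)))"
  have "X (form_class J 1 w) = coeff_field j (form_class J 1 w)" if w: "w \<in> Omega v 1" for w
  proof
    fix m
    have scale: "X (form_class J 1 (form0 (edge_coeff w k) \<odot> Theta_form v k)) =
        (\<lambda>m. edge_coeff w k m * X (Theta v J k) m)" for k
      using X edge_coeff_in_lattice_funs Theta_form_in_Omega
      unfolding vector_fields_def Theta_def by blast
    have "X (form_class J 1 w) m = (\<Sum>k\<in>UNIV. edge_coeff w k m * X (Theta v J k) m)"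
      using X by (subst form_class_expansion[OF w], subst vector_field_sum)
        (auto simp: scale intro: form0_prod_in_Omega Theta_form_in_Omega)
    also have "\<dots> = (\<Sum>k\<in>UNIV. if k = j then edge_coeff w j m else 0)"
      \<comment> \<open>Multiplying by \<open>lattice_one v\<close> changes nothing because
        \<open>edge_coeff\<close> vanishes off the lattice.\<close>
      using X by (intro sum.cong) (auto simp: lattice_one_def edge_coeff_def)
    finally show "X (form_class J 1 w) m = coeff_field j (form_class J 1 w) m"
      by (simp add: coeff_field_class[OF w])
  qed
  moreover have "X \<in> Lambda v J 1 \<rightarrow>\<^sub>E lattice_funs v" "coeff_field j \<in> Lambda v J 1 \<rightarrow>\<^sub>E lattice_funs v"
    using X coeff_field_in_vector_fields unfolding vector_fields_def by blast+
  ultimately show "X = coeff_field j"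
    by (intro PiE_ext) (auto simp: Lambda_def)
qed

section \<open>Difference operators and their commutation\<close>

lemma vf_partial_eq:
  "vf_partial v J j f = (\<lambda>m. if m \<in> lattice v then f (m + step v j) - f m else 0)"
  using ext_deriv_form0_edge[OF _ lattice_add[OF _ step_in_lattice] edge_distinct]
  by (auto simp: vf_partial_def basis_field_eq coeff_field_class ext_deriv_form0_in_Omega
      edge_coeff_def)

end

theorem corollary3p1:
  fixes v :: "'n::finite \<Rightarrow> real ^ 'n"
    and J :: "nat \<Rightarrow> 'n form set"
  assumes "inj v" and "independent (range v)"
    and "symmetric_lattice_reduction v J"
    and "no_opposite_edges v J"
  shows "\<forall>j k. \<forall>f\<in>lattice_funs v.
    vf_partial v J j (vf_partial v J k f) = vf_partial v J k (vf_partial v J j f)"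
proof -
  interpret reduction v J
    using assms by unfold_locales
  show ?thesis
    \<comment> \<open>At a lattice point \<open>m\<close> the shifted points stay in the lattice,
      and both sides become \<open>f (m + step v j + step v k) - f (m + step v j) - f (m + step v k)
      + f m\<close>; off the lattice both are zero.\<close>
    using lattice_add[OF _ step_in_lattice, of _ v]
    by (auto simp: vf_partial_eq fun_eq_iff algebra_simps)
qed

end
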